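(* Let $A$ be a commutative ring and $\mathfrak{a} \subseteq A$ a finitely generated ideal. Let $M$ be an $A$-module, with a filtration $\{F^i(M)\}_{i \in I}$ by $A$-submodules indexed by a directed set $(I, \leq)$. Assume that $M$ is $F$-adically complete, and that the $F$-adic topology on $M$ is weaker than the $\mathfrak{a}$-adic topology on $M$. Then $M$ is $\mathfrak{a}$-adically complete.
   Context: No noetherian hypothesis on $A$ and no finite generation hypothesis on $M$ is made; $I$ need not be countable. A directed set $(I,\leq)$ is a quasi-ordered set in which any two elements have an upper bound. A filtration $\{F^i(M)\}_{i\in I}$ of $M$ is an inverse system of $A$-submodules of $M$ indexed by $I$, i.e. $F^j(M) \subseteq F^i(M)$ whenever $i \leq j$. The $F$-adic completion of $M$ is $\Lambda_F(M) := \varprojlim_{i} M/F^i(M)$, and $M$ is $F$-adically complete if the canonical homomorphism $\tau_{M,F} : M \to \Lambda_F(M)$ is an isomorphism (so completeness includes separatedness). The $\mathfrak{a}$-adic filtration is $\{\mathfrak{a}^i \cdot M\}_{i \in \mathbb{N}}$, the $\mathfrak{a}$-adic completion of $M$ is $\Lambda_{\mathfrak a}(M) := \varprojlim_i M/\mathfrak{a}^i \cdot M$, and $M$ is $\mathfrak{a}$-adically complete if the canonical homomorphism $\tau_{M,\mathfrak a} : M \to \Lambda_{\mathfrak a}(M)$ is an isomorphism. The $F$-adic topology is weaker than the $\mathfrak{a}$-adic topology if for every $i \in I$ there exists $j \in \mathbb{N}$ such that $\mathfrak{a}^j \cdot M \subseteq F^i(M)$. *)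

theory Defs
  imports "HOL-Algebra.Module" "HOL-Algebra.Ideal_Product"
begin

definition directed_set :: "'i set \<Rightarrow> ('i \<Rightarrow> 'i \<Rightarrow> bool) \<Rightarrow> bool"
  where "directed_set I leq \<longleftrightarrow>
    reflp_on I leq \<and> transp_on I leq \<and> (\<forall>i\<in>I. \<forall>j\<in>I. \<exists>k\<in>I. leq i k \<and> leq j k)"

definition finitely_generated_ideal :: "('a, 'b) ring_scheme \<Rightarrow> 'a set \<Rightarrow> bool"
  where "finitely_generated_ideal R \<aa> \<longleftrightarrow>
    ideal \<aa> R \<and> (\<exists>S. S \<subseteq> carrier R \<and> finite S \<and> \<aa> = genideal R S)"

definition module_iso ::
  "('a, 'b) ring_scheme \<Rightarrow> ('a, 'm, 'p) module_scheme \<Rightarrow> ('a, 'n, 'q) module_scheme \<Rightarrow> ('m \<Rightarrow> 'n) set"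
  where "module_iso R M N =
    {f. f \<in> hom (add_monoid M) (add_monoid N) \<and>
        (\<forall>r\<in>carrier R. \<forall>x\<in>carrier M. f (r \<odot>\<^bsub>M\<^esub> x) = r \<odot>\<^bsub>N\<^esub> f x) \<and>
        bij_betw f (carrier M) (carrier N)}"

text \<open>The record type of modules extends that of rings, so the fields \<open>mult\<close> and \<open>one\<close> have to
  be filled in below although they play no role for modules.\<close>

definition quotient_module ::
  "('a, 'm, 'p) module_scheme \<Rightarrow> 'm set \<Rightarrow> ('a, 'm set) module"
  where "quotient_module M N =
    \<lparr>carrier = a_rcosets\<^bsub>M\<^esub> N, mult = (\<lambda>_ _. undefined), one = undefined,
     zero = N, add = set_add M, smult = (\<lambda>r X. \<Union>x\<in>X. N +>\<^bsub>M\<^esub> (r \<odot>\<^bsub>M\<^esub> x))\<rparr>"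

text \<open>For \<open>N' \<subseteq> N\<close>, the projection from \<open>M / N'\<close> to \<open>M / N\<close>.\<close>

definition quotient_proj :: "('a, 'm, 'p) module_scheme \<Rightarrow> 'm set \<Rightarrow> 'm set \<Rightarrow> 'm set"
  where "quotient_proj M N X = (\<Union>x\<in>X. N +>\<^bsub>M\<^esub> x)"

text \<open>Here \<open>\<phi> i j\<close>, for \<open>leq i j\<close>, is the transition map from \<open>Q j\<close> to \<open>Q i\<close>.\<close>

definition inverse_limit ::
  "'i set \<Rightarrow> ('i \<Rightarrow> 'i \<Rightarrow> bool) \<Rightarrow> ('i \<Rightarrow> ('a, 'n, 'q) module_scheme) \<Rightarrow>
   ('i \<Rightarrow> 'i \<Rightarrow> 'n \<Rightarrow> 'n) \<Rightarrow> ('a, 'i \<Rightarrow> 'n) module"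
  where "inverse_limit I leq Q \<phi> =
    \<lparr>carrier = {x \<in> (\<Pi>\<^sub>E i\<in>I. carrier (Q i)). \<forall>i\<in>I. \<forall>j\<in>I. leq i j \<longrightarrow> \<phi> i j (x j) = x i},
     mult = (\<lambda>_ _. undefined), one = undefined,
     zero = (\<lambda>i\<in>I. \<zero>\<^bsub>Q i\<^esub>),
     add = (\<lambda>x y. \<lambda>i\<in>I. x i \<oplus>\<^bsub>Q i\<^esub> y i),
     smult = (\<lambda>r x. \<lambda>i\<in>I. r \<odot>\<^bsub>Q i\<^esub> x i)\<rparr>"

definition filtration ::
  "('a, 'b) ring_scheme \<Rightarrow> ('a, 'm, 'p) module_scheme \<Rightarrow> 'i set \<Rightarrow> ('i \<Rightarrow> 'i \<Rightarrow> bool) \<Rightarrow>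
   ('i \<Rightarrow> 'm set) \<Rightarrow> bool"
  where "filtration R M I leq F \<longleftrightarrow>
    (\<forall>i\<in>I. submodule (F i) R M) \<and> (\<forall>i\<in>I. \<forall>j\<in>I. leq i j \<longrightarrow> F j \<subseteq> F i)"

definition completion ::
  "('a, 'm, 'p) module_scheme \<Rightarrow> 'i set \<Rightarrow> ('i \<Rightarrow> 'i \<Rightarrow> bool) \<Rightarrow> ('i \<Rightarrow> 'm set) \<Rightarrow>
   ('a, 'i \<Rightarrow> 'm set) module"
  where "completion M I leq F =
    inverse_limit I leq (\<lambda>i. quotient_module M (F i)) (\<lambda>i j. quotient_proj M (F i))"

definition completion_map ::
  "('a, 'm, 'p) module_scheme \<Rightarrow> 'i set \<Rightarrow> ('i \<Rightarrow> 'm set) \<Rightarrow> 'm \<Rightarrow> 'i \<Rightarrow> 'm set"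
  where "completion_map M I F m = (\<lambda>i\<in>I. F i +>\<^bsub>M\<^esub> m)"

definition filtration_complete ::
  "('a, 'b) ring_scheme \<Rightarrow> ('a, 'm, 'p) module_scheme \<Rightarrow> 'i set \<Rightarrow> ('i \<Rightarrow> 'i \<Rightarrow> bool) \<Rightarrow>
   ('i \<Rightarrow> 'm set) \<Rightarrow> bool"
  where "filtration_complete R M I leq F \<longleftrightarrow>
    completion_map M I F \<in> module_iso R M (completion M I leq F)"

text \<open>For an ideal \<open>J\<close> and a submodule \<open>N\<close>, the submodule \<open>J \<cdot> N\<close> of finite sums of products,
  built in the same way as \<^const>\<open>ideal_prod\<close>.\<close>

inductive_set ideal_module_prod ::
  "('a, 'm, 'p) module_scheme \<Rightarrow> 'a set \<Rightarrow> 'm set \<Rightarrow> 'm set"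
  for M and J and N where
    smult: "r \<in> J \<Longrightarrow> x \<in> N \<Longrightarrow> r \<odot>\<^bsub>M\<^esub> x \<in> ideal_module_prod M J N"
  | add: "x \<in> ideal_module_prod M J N \<Longrightarrow> y \<in> ideal_module_prod M J N \<Longrightarrow>
      x \<oplus>\<^bsub>M\<^esub> y \<in> ideal_module_prod M J N"

text \<open>Powers are taken in the multiplicative monoid of ideals, whose unit is the whole ring.\<close>

definition adic_filtration ::
  "('a, 'b) ring_scheme \<Rightarrow> ('a, 'm, 'p) module_scheme \<Rightarrow> 'a set \<Rightarrow> nat \<Rightarrow> 'm set"
  where "adic_filtration R M \<aa> n =
    ideal_module_prod M (\<aa> [^]\<^bsub>ideals_set R\<^esub> n) (carrier M)"

definition adically_complete ::
  "('a, 'b) ring_scheme \<Rightarrow> ('a, 'm, 'p) module_scheme \<Rightarrow> 'a set \<Rightarrow> bool"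
  where "adically_complete R M \<aa> \<longleftrightarrow>
    filtration_complete R M (UNIV :: nat set) (\<le>) (adic_filtration R M \<aa>)"

definition weaker_than_adic ::
  "('a, 'b) ring_scheme \<Rightarrow> ('a, 'm, 'p) module_scheme \<Rightarrow> 'a set \<Rightarrow> 'i set \<Rightarrow> ('i \<Rightarrow> 'm set) \<Rightarrow> bool"
  where "weaker_than_adic R M \<aa> I F \<longleftrightarrow>
    (\<forall>i\<in>I. \<exists>j. adic_filtration R M \<aa> j \<subseteq> F i)"

end

theory Submission
  imports Defs
begin

text \<open>Let \<open>(z\<^sub>n)\<close> be a sequence in \<open>M\<close> with \<open>z\<^sub>n\<^sub>+\<^sub>1 - z\<^sub>n \<in> \<aa>\<^sup>nM\<close>. It is Cauchy for the
  \<open>F\<close>-adic topology, so it has an \<open>F\<close>-adic limit \<open>x\<close>. For fixed \<open>n\<close>, the difference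
  \<open>x - z\<^sub>n\<close> is the \<open>F\<close>-adic sum of a series with terms in \<open>\<aa>\<^sup>k\<^sup>+\<^sup>nM\<close>. Writing the terms as
  combinations of the finitely many generators of \<open>\<aa>\<close>, with coefficients in
  \<open>\<aa>\<^sup>k\<^sup>+\<^sup>n\<^sup>-\<^sup>1M\<close>, and exchanging the finite sum with the limit gives \<open>x - z\<^sub>n \<in> \<aa>\<^sup>nM\<close> by
  induction on \<open>n\<close>, because \<open>F\<close>-adic limits are unique. So \<open>x\<close> is also the
  \<open>\<aa>\<close>-adic limit.\<close>

section \<open>Subtraction in abelian groups\<close>

lemma (in abelian_group) minus_eq_zero_iff:
  assumes "x \<in> carrier G" "y \<in> carrier G"
  shows "x \<ominus> y = \<zero> \<longleftrightarrow> x = y"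
  using assms minus_equality[of x "\<ominus> y"] by (auto simp: a_minus_def r_neg)

lemma (in abelian_group) minus_zero_right:
  assumes "x \<in> carrier G"
  shows "x \<ominus> \<zero> = x"
proof -
  have "\<ominus> \<zero> = \<zero>" by (rule minus_equality) auto
  then show ?thesis using assms by (simp add: a_minus_def)
qed

lemma (in abelian_group) minus_minus_cancel_right:
  assumes "x \<in> carrier G" "y \<in> carrier G" "z \<in> carrier G"
  shows "(x \<ominus> z) \<ominus> (y \<ominus> z) = x \<ominus> y"
proof -
  have "(x \<ominus> z) \<ominus> (y \<ominus> z) = x \<oplus> (\<ominus> y \<oplus> (z \<oplus> \<ominus> z))"
    using assms by (simp add: a_minus_def minus_add a_ac)
  then show ?thesis using assms by (simp add: r_neg a_minus_def)
qed

section \<open>Cosets of submodules and the quotient operations\<close>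

lemma (in module) submodule_abelian_subgroup:
  assumes "submodule N R M"
  shows "abelian_subgroup N M"
  using assms M.abelian_group_axioms
  by (intro abelian_subgroupI3 additive_subgroup.intro) (auto simp: submodule_def)

lemma (in module) carrier_submodule: "submodule (carrier M) R M"
  by (rule submoduleI) auto

text \<open>Turns congruence modulo \<open>N\<close> into an equality of sets, so that symmetry and
  transitivity of congruence become those of equality.\<close>

lemma (in module) submodule_rcos_eq_iff:
  assumes "submodule N R M" "x \<in> carrier M" "y \<in> carrier M"
  shows "N +>\<^bsub>M\<^esub> x = N +>\<^bsub>M\<^esub> y \<longleftrightarrow> x \<ominus>\<^bsub>M\<^esub> y \<in> N"
proof -
  interpret N: abelian_subgroup N M using assms(1) by (rule submodule_abelian_subgroup)
  have "x \<ominus>\<^bsub>M\<^esub> y \<in> N \<longleftrightarrow> x \<in> N +>\<^bsub>M\<^esub> y"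
    using N.a_rcos_module[OF assms(3,2)] by (simp add: a_minus_def)
  also have "\<dots> \<longleftrightarrow> N +>\<^bsub>M\<^esub> x = N +>\<^bsub>M\<^esub> y"
    using N.a_rcos_self[OF assms(2)] M.a_repr_independence[OF _ assms(3) N.a_subgroup] by metis
  finally show ?thesis by simp
qed

text \<open>Elements congruent modulo \<open>N'\<close> are congruent modulo the larger
  \<open>N\<close>, so the union defining \<open>quotient_proj\<close> ranges over copies of one
  coset.\<close>

lemma (in module) quotient_proj_rcos:
  assumes "submodule N R M" "submodule N' R M" "N' \<subseteq> N" "x \<in> carrier M"
  shows "quotient_proj M N (N' +>\<^bsub>M\<^esub> x) = N +>\<^bsub>M\<^esub> x"
proof -
  interpret N': abelian_subgroup N' M using assms(2) by (rule submodule_abelian_subgroup)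
  have "N +>\<^bsub>M\<^esub> y = N +>\<^bsub>M\<^esub> x" if y: "y \<in> N' +>\<^bsub>M\<^esub> x" for y
  proof -
    have yc: "y \<in> carrier M" using N'.a_elemrcos_carrier[OF assms(4) y] .
    have "N' +>\<^bsub>M\<^esub> y = N' +>\<^bsub>M\<^esub> x"
      using M.a_repr_independence[OF y assms(4) N'.a_subgroup] by simp
    then show ?thesis using assms yc by (auto simp: submodule_rcos_eq_iff)
  qed
  \<comment> \<open>The union of a constant family equals its value only over a nonempty index set;
    the coset contains \<open>x\<close>.\<close>
  then show ?thesis
    using N'.a_rcos_self[OF assms(4)] unfolding quotient_proj_def by (intro SUP_eq_const) blast+
qed

text \<open>Scalar multiplication on the quotient is independent of the representative:
  \<open>N\<close> absorbs \<open>r\<close> times the difference of two representatives, so the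
  defining union is again constant.\<close>

lemma (in module) quotient_module_smult:
  assumes "submodule N R M" "r \<in> carrier R" "x \<in> carrier M"
  shows "r \<odot>\<^bsub>quotient_module M N\<^esub> (N +>\<^bsub>M\<^esub> x) = N +>\<^bsub>M\<^esub> (r \<odot>\<^bsub>M\<^esub> x)"
proof -
  interpret N: abelian_subgroup N M using assms(1) by (rule submodule_abelian_subgroup)
  have "N +>\<^bsub>M\<^esub> (r \<odot>\<^bsub>M\<^esub> y) = N +>\<^bsub>M\<^esub> (r \<odot>\<^bsub>M\<^esub> x)" if y: "y \<in> N +>\<^bsub>M\<^esub> x" for y
  proof -
    have yc: "y \<in> carrier M" using N.a_elemrcos_carrier[OF assms(3) y] .
    have "y \<ominus>\<^bsub>M\<^esub> x \<in> N"
      using M.a_repr_independence[OF y assms(3) N.a_subgroup] assms yc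
      by (simp flip: submodule_rcos_eq_iff)
    then have "r \<odot>\<^bsub>M\<^esub> (y \<ominus>\<^bsub>M\<^esub> x) \<in> N"
      using assms by (simp add: submodule.smult_closed)
    then show ?thesis
      using assms yc by (simp add: submodule_rcos_eq_iff a_minus_def smult_r_distr smult_r_minus)
  qed
  then show ?thesis
    using N.a_rcos_self[OF assms(3)] unfolding quotient_module_def module.simps
    by (intro SUP_eq_const) blast+
qed

section \<open>Completeness as separatedness plus surjectivity\<close>

text \<open>The canonical map is always a homomorphism into the completion, so only bijectivity is
  at stake. Its kernel is the intersection of all \<open>F i\<close>, which gives the first
  conjunct; the second is surjectivity.\<close>

lemma (in module) filtration_complete_iff:
  assumes "filtration R M I leq F"
  shows "filtration_complete R M I leq F \<longleftrightarrow>
    (\<forall>x\<in>carrier M. (\<forall>i\<in>I. x \<in> F i) \<longrightarrow> x = \<zero>\<^bsub>M\<^esub>) \<and>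
    carrier (completion M I leq F) \<subseteq> completion_map M I F ` carrier M"
proof -
  have sub: "submodule (F i) R M" if "i \<in> I" for i
    using assms that by (auto simp: filtration_def)
  have mono: "F j \<subseteq> F i" if "i \<in> I" "j \<in> I" "leq i j" for i j
    using assms that by (auto simp: filtration_def)
  have Fc: "F i \<subseteq> carrier M" if "i \<in> I" for i
    using sub[OF that] by (simp add: submodule_def subgroup_def)
  have into: "completion_map M I F x \<in> carrier (completion M I leq F)" if "x \<in> carrier M" for x
    using that sub mono M.a_rcosetsI[OF Fc]
    by (auto simp: completion_def inverse_limit_def completion_map_def quotient_module_def
        quotient_proj_rcos)
  have add: "completion_map M I F (x \<oplus>\<^bsub>M\<^esub> y) =
      completion_map M I F x \<oplus>\<^bsub>completion M I leq F\<^esub> completion_map M I F y"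
    if "x \<in> carrier M" "y \<in> carrier M" for x y
    using that abelian_subgroup.a_rcos_sum[OF submodule_abelian_subgroup[OF sub]]
    by (auto simp: completion_def inverse_limit_def completion_map_def quotient_module_def
        intro!: restrict_ext)
  have smult: "completion_map M I F (r \<odot>\<^bsub>M\<^esub> x) =
      r \<odot>\<^bsub>completion M I leq F\<^esub> completion_map M I F x"
    if "r \<in> carrier R" "x \<in> carrier M" for r x
    using that quotient_module_smult[OF sub]
    by (auto simp: completion_def inverse_limit_def completion_map_def intro!: restrict_ext)
  have eq: "completion_map M I F x = completion_map M I F y \<longleftrightarrow> (\<forall>i\<in>I. x \<ominus>\<^bsub>M\<^esub> y \<in> F i)"
    if "x \<in> carrier M" "y \<in> carrier M" for x y
    using that sub unfolding completion_map_def
    by (auto simp: submodule_rcos_eq_iff fun_eq_iff restrict_def)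
  have inj: "inj_on (completion_map M I F) (carrier M) \<longleftrightarrow>
      (\<forall>x\<in>carrier M. (\<forall>i\<in>I. x \<in> F i) \<longrightarrow> x = \<zero>\<^bsub>M\<^esub>)" (is "?L \<longleftrightarrow> ?R")
  proof
    assume L: ?L
    show ?R
    proof (intro ballI impI)
      fix x assume x: "x \<in> carrier M" "\<forall>i\<in>I. x \<in> F i"
      then have "completion_map M I F x = completion_map M I F \<zero>\<^bsub>M\<^esub>"
        by (simp add: eq M.minus_zero_right)
      then show "x = \<zero>\<^bsub>M\<^esub>" using L x by (auto dest: inj_onD)
    qed
  next
    assume R: ?R
    show ?L
    proof (rule inj_onI)
      fix x y assume xy: "x \<in> carrier M" "y \<in> carrier M"
        and "completion_map M I F x = completion_map M I F y"
      then have "x \<ominus>\<^bsub>M\<^esub> y = \<zero>\<^bsub>M\<^esub>" using R by (simp add: eq)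
      then show "x = y" using xy by (simp add: M.minus_eq_zero_iff)
    qed
  qed
  show ?thesis
    unfolding filtration_complete_def module_iso_def bij_betw_def inj[symmetric]
    using into add smult by (auto simp: hom_def Pi_def)
qed

section \<open>Products of ideals with submodules\<close>

lemma (in module) ideal_module_prod_subset:
  assumes "J \<subseteq> carrier R" "submodule N R M"
  shows "ideal_module_prod M J N \<subseteq> N"
proof
  interpret N: abelian_subgroup N M using assms(2) by (rule submodule_abelian_subgroup)
  fix x assume "x \<in> ideal_module_prod M J N"
  then show "x \<in> N"
    by induction (use assms in \<open>auto intro: submodule.smult_closed[OF assms(2)]\<close>)
qed

lemma (in module) ideal_module_prod_submodule:
  assumes "ideal J R" "submodule N R M"
  shows "submodule (ideal_module_prod M J N) R M"
proof -
  interpret J: ideal J R by fact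
  interpret N: abelian_subgroup N M using assms(2) by (rule submodule_abelian_subgroup)
  have c: "ideal_module_prod M J N \<subseteq> carrier M"
    using ideal_module_prod_subset[OF J.a_subset assms(2)] N.a_subset by blast
  show ?thesis
  proof (rule submoduleI)
    show "ideal_module_prod M J N \<subseteq> carrier M" by (rule c)
    show "\<zero>\<^bsub>M\<^esub> \<in> ideal_module_prod M J N"
      using ideal_module_prod.smult[of \<zero> J "\<zero>\<^bsub>M\<^esub>" N M] by simp
    show "x \<oplus>\<^bsub>M\<^esub> y \<in> ideal_module_prod M J N"
      if "x \<in> ideal_module_prod M J N" "y \<in> ideal_module_prod M J N" for x y
      using that by (rule ideal_module_prod.add)
    show smult: "a \<odot>\<^bsub>M\<^esub> x \<in> ideal_module_prod M J N"
      if a: "a \<in> carrier R" and x: "x \<in> ideal_module_prod M J N" for a x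
      using x
    proof induction
      case (smult r x)
      then show ?case using ideal_module_prod.smult[of "a \<otimes> r" J x N M] a
        by (simp add: smult_assoc1 J.I_l_closed)
    next
      case (add x y)
      then show ?case using a c by (simp add: smult_r_distr subset_iff ideal_module_prod.add)
    qed
    \<comment> \<open>The inductive set has no rule for negatives; they arise as multiples by
      \<open>\<ominus> \<one>\<close>.\<close>
    show "\<ominus>\<^bsub>M\<^esub> x \<in> ideal_module_prod M J N" if "x \<in> ideal_module_prod M J N" for x
      using smult[of "\<ominus> \<one>" x] that c by (simp add: smult_l_minus subset_iff)
  qed
qed

text \<open>Each inclusion reduces to a single product: an induction over the sums in
  \<open>J \<cdot> K\<close> for one, over those in the product of \<open>K\<close> and
  \<open>N\<close> for the other. It serves to split one factor \<aa> off a power.\<close>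

lemma (in module) ideal_module_prod_assoc:
  assumes J: "ideal J R" and K: "ideal K R" and N: "submodule N R M"
  shows "ideal_module_prod M (J \<cdot> K) N = ideal_module_prod M J (ideal_module_prod M K N)"
    (is "?L = ?R")
proof -
  interpret J: ideal J R by fact
  interpret K: ideal K R by fact
  interpret N: abelian_subgroup N M using N by (rule submodule_abelian_subgroup)
  have KN: "ideal_module_prod M K N \<subseteq> carrier M"
    using ideal_module_prod_subset[OF K.a_subset N] N.a_subset by blast
  have JK: "J \<cdot> K \<subseteq> carrier R" by (rule R.ideal_prod_in_carrier[OF J K])
  have 1: "a \<odot>\<^bsub>M\<^esub> x \<in> ?R" if "a \<in> J \<cdot> K" "x \<in> N" for a x
    using that
  proof induction
    case (prod i j)
    then show ?case
      using ideal_module_prod.smult[OF prod(1) ideal_module_prod.smult[OF prod(2)], of x N M]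
      by (simp add: smult_assoc1)
  next
    case (sum a b)
    then show ?case using JK by (simp add: smult_l_distr subset_iff ideal_module_prod.add)
  qed
  have 2: "j \<odot>\<^bsub>M\<^esub> x \<in> ?L" if j: "j \<in> J" and x: "x \<in> ideal_module_prod M K N" for j x
    using x
  proof induction
    case (smult r x)
    then show ?case
      using ideal_module_prod.smult[OF ideal_prod.prod[OF j smult(1), of R], of x N M] j smult
      by (simp flip: smult_assoc1)
  next
    case (add x y)
    then show ?case using KN j by (simp add: smult_r_distr subset_iff ideal_module_prod.add)
  qed
  show ?thesis
  proof (intro equalityI subsetI)
    show "x \<in> ?R" if "x \<in> ?L" for x
      using that by induction (auto intro: 1 ideal_module_prod.add)
    show "x \<in> ?L" if "x \<in> ?R" for x
      using that by induction (auto intro: 2 ideal_module_prod.add)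
  qed
qed

lemma (in module) ideal_module_prod_genideal_finsum:
  assumes S: "finite S" "S \<subseteq> carrier R" and N: "submodule N R M"
    and z: "z \<in> ideal_module_prod M (Idl S) N"
  shows "\<exists>y\<in>S \<rightarrow> N. z = (\<Oplus>\<^bsub>M\<^esub>s\<in>S. s \<odot>\<^bsub>M\<^esub> y s)"
proof -
  interpret N: abelian_subgroup N M using N by (rule submodule_abelian_subgroup)
  define T where "T = {z. \<exists>y\<in>S \<rightarrow> N. z = (\<Oplus>\<^bsub>M\<^esub>s\<in>S. s \<odot>\<^bsub>M\<^esub> y s)}"
  have Tadd: "u \<oplus>\<^bsub>M\<^esub> v \<in> T" if "u \<in> T" "v \<in> T" for u v
  proof -
    obtain y y' where y: "y \<in> S \<rightarrow> N" "u = (\<Oplus>\<^bsub>M\<^esub>s\<in>S. s \<odot>\<^bsub>M\<^esub> y s)"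
      and y': "y' \<in> S \<rightarrow> N" "v = (\<Oplus>\<^bsub>M\<^esub>s\<in>S. s \<odot>\<^bsub>M\<^esub> y' s)"
      using \<open>u \<in> T\<close> \<open>v \<in> T\<close> unfolding T_def by blast
    have "(\<Oplus>\<^bsub>M\<^esub>s\<in>S. s \<odot>\<^bsub>M\<^esub> (y s \<oplus>\<^bsub>M\<^esub> y' s)) =
        (\<Oplus>\<^bsub>M\<^esub>s\<in>S. s \<odot>\<^bsub>M\<^esub> y s \<oplus>\<^bsub>M\<^esub> s \<odot>\<^bsub>M\<^esub> y' s)"
      using S y y' by (intro M.finsum_cong') (auto simp: Pi_iff subset_iff smult_r_distr)
    also have "\<dots> = u \<oplus>\<^bsub>M\<^esub> v"
      unfolding y y' using S y y' by (intro M.finsum_addf) (auto simp: Pi_iff subset_iff)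
    finally show ?thesis unfolding T_def using y y'
      by (auto simp: Pi_iff intro!: bexI[of _ "\<lambda>s. y s \<oplus>\<^bsub>M\<^esub> y' s"])
  qed
  have Tsmult: "r \<odot>\<^bsub>M\<^esub> u \<in> T" if r: "r \<in> carrier R" and "u \<in> T" for r u
  proof -
    obtain y where y: "y \<in> S \<rightarrow> N" "u = (\<Oplus>\<^bsub>M\<^esub>s\<in>S. s \<odot>\<^bsub>M\<^esub> y s)"
      using \<open>u \<in> T\<close> unfolding T_def by blast
    have "r \<odot>\<^bsub>M\<^esub> u = (\<Oplus>\<^bsub>M\<^esub>s\<in>S. r \<odot>\<^bsub>M\<^esub> (s \<odot>\<^bsub>M\<^esub> y s))"
      unfolding y using S y r by (intro finsum_smult_ldistr) (auto simp: Pi_iff subset_iff)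
    also have "\<dots> = (\<Oplus>\<^bsub>M\<^esub>s\<in>S. s \<odot>\<^bsub>M\<^esub> (r \<odot>\<^bsub>M\<^esub> y s))"
      using S y r by (intro M.finsum_cong')
        (auto simp: Pi_iff subset_iff R.m_comm simp flip: smult_assoc1)
    finally show ?thesis unfolding T_def using y r N
      by (auto simp: Pi_iff submodule.smult_closed intro!: bexI[of _ "\<lambda>s. r \<odot>\<^bsub>M\<^esub> y s"])
  qed
  have Tc: "T \<subseteq> carrier M"
    using S by (fastforce simp: T_def Pi_iff subset_iff intro!: M.finsum_closed)
  have T0: "\<zero>\<^bsub>M\<^esub> \<in> T"
  proof -
    have "(\<Oplus>\<^bsub>M\<^esub>s\<in>S. s \<odot>\<^bsub>M\<^esub> \<zero>\<^bsub>M\<^esub>) = \<zero>\<^bsub>M\<^esub>"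
      using S by (intro M.add.finprod_one_eqI) (auto simp: subset_iff)
    then show ?thesis unfolding T_def by (auto intro!: bexI[of _ "\<lambda>_. \<zero>\<^bsub>M\<^esub>"])
  qed
  have gen: "s \<odot>\<^bsub>M\<^esub> w \<in> T" if s: "s \<in> S" and w: "w \<in> N" for s w
  proof -
    \<comment> \<open>The coefficient family concentrated at the single generator
      \<open>s\<close>.\<close>
    let ?y = "\<lambda>t. if s = t then w else \<zero>\<^bsub>M\<^esub>"
    have "(\<Oplus>\<^bsub>M\<^esub>t\<in>S. t \<odot>\<^bsub>M\<^esub> ?y t) = (\<Oplus>\<^bsub>M\<^esub>t\<in>S. if s = t then t \<odot>\<^bsub>M\<^esub> w else \<zero>\<^bsub>M\<^esub>)"
      using S w by (intro M.finsum_cong') (auto simp: subset_iff)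
    also have "\<dots> = s \<odot>\<^bsub>M\<^esub> w"
      using S s w by (intro M.finsum_singleton) (auto simp: subset_iff)
    finally show ?thesis unfolding T_def using w by (auto intro!: bexI[of _ ?y])
  qed
  have ideal: "r \<odot>\<^bsub>M\<^esub> w \<in> T" if r: "r \<in> Idl S" and w: "w \<in> N" for r w
  proof -
    have wc: "w \<in> carrier M" using w by simp
    \<comment> \<open>For fixed \<open>w\<close>, the scalars carrying \<open>w\<close> into
      \<open>T\<close> form an ideal. It contains \<open>S\<close> by \<open>gen\<close>, hence
      \<open>Idl S\<close> by minimality, which avoids an explicit description of the elements of
      \<open>Idl S\<close>.\<close>
    have "ideal {r \<in> carrier R. r \<odot>\<^bsub>M\<^esub> w \<in> T} R"
    proof (rule idealI[OF R.ring_axioms])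
      show "subgroup {r \<in> carrier R. r \<odot>\<^bsub>M\<^esub> w \<in> T} (add_monoid R)"
      proof (rule R.add.subgroupI)
        show "{r \<in> carrier R. r \<odot>\<^bsub>M\<^esub> w \<in> T} \<noteq> {}" using T0 wc by force
      next
        fix a assume a: "a \<in> {r \<in> carrier R. r \<odot>\<^bsub>M\<^esub> w \<in> T}"
        have "(\<ominus> \<one>) \<odot>\<^bsub>M\<^esub> (a \<odot>\<^bsub>M\<^esub> w) \<in> T" by (rule Tsmult) (use a in auto)
        then show "\<ominus> a \<in> {r \<in> carrier R. r \<odot>\<^bsub>M\<^esub> w \<in> T}"
          using a wc by (simp add: smult_l_minus)
      qed (use wc in \<open>auto simp: smult_l_distr Tadd\<close>)
    next
      fix a x assume a: "a \<in> {r \<in> carrier R. r \<odot>\<^bsub>M\<^esub> w \<in> T}" and x: "x \<in> carrier R"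
      have "x \<odot>\<^bsub>M\<^esub> (a \<odot>\<^bsub>M\<^esub> w) \<in> T" by (rule Tsmult) (use a x in auto)
      then show "x \<otimes> a \<in> {r \<in> carrier R. r \<odot>\<^bsub>M\<^esub> w \<in> T}"
        and "a \<otimes> x \<in> {r \<in> carrier R. r \<odot>\<^bsub>M\<^esub> w \<in> T}"
        using a x wc by (auto simp: R.m_comm[of a x] smult_assoc1)
    qed
    then have "Idl S \<subseteq> {r \<in> carrier R. r \<odot>\<^bsub>M\<^esub> w \<in> T}"
      using S gen[OF _ w] by (intro R.genideal_minimal) auto
    then show ?thesis using r by blast
  qed
  have "z \<in> T" using z by induction (auto intro: ideal Tadd)
  then show ?thesis by (simp add: T_def)
qed

section \<open>The adic filtration\<close>

lemma (in module) adic_filtration_0: "adic_filtration R M \<aa> 0 = carrier M"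
proof -
  have "ideal_module_prod M (carrier R) (carrier M) \<subseteq> carrier M"
    using carrier_submodule by (rule ideal_module_prod_subset[OF subset_refl])
  moreover have "x \<in> ideal_module_prod M (carrier R) (carrier M)" if "x \<in> carrier M" for x
    using ideal_module_prod.smult[of \<one> "carrier R" x "carrier M" M] that by simp
  ultimately show ?thesis
    by (auto simp: adic_filtration_def ideals_set_def nat_pow_def)
qed

lemma (in cring) ideal_pow_is_ideal:
  assumes "ideal J R"
  shows "ideal (J [^]\<^bsub>ideals_set R\<^esub> (n::nat)) R"
proof -
  interpret ideals: comm_monoid "ideals_set R" by (rule ideals_set_is_comm_monoid)
  have "J [^]\<^bsub>ideals_set R\<^esub> n \<in> carrier (ideals_set R)"
    using assms by (intro ideals.nat_pow_closed) (simp add: ideals_set_def)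
  then show ?thesis by (simp add: ideals_set_def)
qed

lemma (in module) adic_filtration_submodule:
  assumes "ideal \<aa> R"
  shows "submodule (adic_filtration R M \<aa> n) R M"
  unfolding adic_filtration_def
  by (intro ideal_module_prod_submodule R.ideal_pow_is_ideal assms carrier_submodule)

lemma (in module) adic_filtration_Suc:
  assumes "ideal \<aa> R"
  shows "adic_filtration R M \<aa> (Suc n) = ideal_module_prod M \<aa> (adic_filtration R M \<aa> n)"
proof -
  have "\<aa> [^]\<^bsub>ideals_set R\<^esub> Suc n = (\<aa> [^]\<^bsub>ideals_set R\<^esub> n) \<cdot> \<aa>"
    by (simp add: nat_pow_def ideals_set_def)
  \<comment> \<open>The power unfolds with the new factor on the right; it has to stand on the left
    so that associativity leaves \<aa> acting on the previous step.\<close>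
  also have "\<dots> = \<aa> \<cdot> (\<aa> [^]\<^bsub>ideals_set R\<^esub> n)"
    by (intro R.ideal_prod_commute R.ideal_pow_is_ideal assms)
  finally show ?thesis
    unfolding adic_filtration_def
    by (simp add: ideal_module_prod_assoc R.ideal_pow_is_ideal assms carrier_submodule)
qed

lemma (in module) adic_filtration_antimono:
  assumes "ideal \<aa> R" "m \<le> n"
  shows "adic_filtration R M \<aa> n \<subseteq> adic_filtration R M \<aa> m"
  using assms(2)
proof (induction rule: dec_induct)
  case (step n)
  have "adic_filtration R M \<aa> (Suc n) \<subseteq> adic_filtration R M \<aa> n"
    unfolding adic_filtration_Suc[OF assms(1)]
    using assms(1) by (intro ideal_module_prod_subset adic_filtration_submodule)
      (auto simp: ideal.Icarr)
  then show ?case using step by blast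
qed simp

lemma (in module) adic_filtration_filtration:
  assumes "ideal \<aa> R"
  shows "filtration R M UNIV (\<le>) (adic_filtration R M \<aa>)"
  unfolding filtration_def
  using adic_filtration_submodule adic_filtration_antimono assms by blast

section \<open>Limits of sequences with respect to a filtration\<close>

text \<open>Convergence in the topology with the \<open>F i\<close> as basic neighbourhoods of zero.
  Sequences suffice, whatever the size of \<open>I\<close>, because those considered are Cauchy for
  the \<aa>-adic topology.\<close>

definition filtration_limit ::
  "('a, 'm, 'p) module_scheme \<Rightarrow> 'i set \<Rightarrow> ('i \<Rightarrow> 'm set) \<Rightarrow> (nat \<Rightarrow> 'm) \<Rightarrow> 'm \<Rightarrow> bool"
  where "filtration_limit M I F z x \<longleftrightarrow>
    x \<in> carrier M \<and> (\<forall>i\<in>I. eventually (\<lambda>k. z k \<ominus>\<^bsub>M\<^esub> x \<in> F i) sequentially)"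

lemma (in module) submodule_diff_trans:
  assumes "submodule N R M" "x \<ominus>\<^bsub>M\<^esub> y \<in> N" "y \<ominus>\<^bsub>M\<^esub> w \<in> N"
    "x \<in> carrier M" "y \<in> carrier M" "w \<in> carrier M"
  shows "x \<ominus>\<^bsub>M\<^esub> w \<in> N"
  using assms by (simp flip: submodule_rcos_eq_iff)

lemma (in module) submodule_diff_sym:
  assumes "submodule N R M" "x \<ominus>\<^bsub>M\<^esub> y \<in> N" "x \<in> carrier M" "y \<in> carrier M"
  shows "y \<ominus>\<^bsub>M\<^esub> x \<in> N"
  using assms by (simp flip: submodule_rcos_eq_iff)

text \<open>At a late index both limits are congruent to the same term modulo \<open>F i\<close>, so
  their difference lies in every \<open>F i\<close> and vanishes by separatedness.\<close>

lemma (in module) filtration_limit_unique: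
  assumes F: "filtration R M I leq F" and complete: "filtration_complete R M I leq F"
    and z: "\<And>k. z k \<in> carrier M"
    and x: "filtration_limit M I F z x" and y: "filtration_limit M I F z y"
  shows "x = y"
proof -
  have xy: "x \<in> carrier M" "y \<in> carrier M" using x y by (auto simp: filtration_limit_def)
  have "x \<ominus>\<^bsub>M\<^esub> y \<in> F i" if i: "i \<in> I" for i
  proof -
    have sub: "submodule (F i) R M" using F i by (auto simp: filtration_def)
    have "eventually (\<lambda>k. z k \<ominus>\<^bsub>M\<^esub> x \<in> F i \<and> z k \<ominus>\<^bsub>M\<^esub> y \<in> F i) sequentially"
      using x y i by (auto simp: filtration_limit_def intro: eventually_conj)
    then obtain k where "z k \<ominus>\<^bsub>M\<^esub> x \<in> F i" "z k \<ominus>\<^bsub>M\<^esub> y \<in> F i"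
      by (auto simp: eventually_sequentially)
    then show ?thesis using submodule_diff_trans[OF sub] submodule_diff_sym[OF sub] xy z by blast
  qed
  then have "x \<ominus>\<^bsub>M\<^esub> y = \<zero>\<^bsub>M\<^esub>"
    using complete xy by (simp add: filtration_complete_iff[OF F])
  then show ?thesis using xy by (simp add: M.minus_eq_zero_iff)
qed

lemma (in module) filtration_limit_finsum_smult:
  assumes F: "filtration R M I leq F" and S: "finite S" "S \<subseteq> carrier R"
    and z: "\<And>s k. s \<in> S \<Longrightarrow> z s k \<in> carrier M"
    and x: "\<And>s. s \<in> S \<Longrightarrow> filtration_limit M I F (z s) (x s)"
  shows "filtration_limit M I F (\<lambda>k. \<Oplus>\<^bsub>M\<^esub>s\<in>S. s \<odot>\<^bsub>M\<^esub> z s k) (\<Oplus>\<^bsub>M\<^esub>s\<in>S. s \<odot>\<^bsub>M\<^esub> x s)"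
  unfolding filtration_limit_def
proof (intro conjI ballI)
  have xc: "x s \<in> carrier M" if "s \<in> S" for s using x[OF that] by (simp add: filtration_limit_def)
  show "(\<Oplus>\<^bsub>M\<^esub>s\<in>S. s \<odot>\<^bsub>M\<^esub> x s) \<in> carrier M"
    using S xc by (intro M.finsum_closed) auto
  fix i assume i: "i \<in> I"
  have sub: "submodule (F i) R M" using F i by (auto simp: filtration_def)
  interpret Fi: abelian_subgroup "F i" M using sub by (rule submodule_abelian_subgroup)
  \<comment> \<open>Finiteness of \<open>S\<close> yields one threshold valid for all
    \<open>s\<close> at once.\<close>
  have "eventually (\<lambda>k. \<forall>s\<in>S. z s k \<ominus>\<^bsub>M\<^esub> x s \<in> F i) sequentially"
    using S(1) x i by (auto simp: filtration_limit_def intro!: eventually_ball_finite)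
  then show "eventually (\<lambda>k. (\<Oplus>\<^bsub>M\<^esub>s\<in>S. s \<odot>\<^bsub>M\<^esub> z s k) \<ominus>\<^bsub>M\<^esub> (\<Oplus>\<^bsub>M\<^esub>s\<in>S. s \<odot>\<^bsub>M\<^esub> x s) \<in> F i)
      sequentially"
  proof eventually_elim
    case (elim k)
    have "T \<subseteq> S \<Longrightarrow> (\<Oplus>\<^bsub>M\<^esub>s\<in>T. s \<odot>\<^bsub>M\<^esub> z s k) \<ominus>\<^bsub>M\<^esub> (\<Oplus>\<^bsub>M\<^esub>s\<in>T. s \<odot>\<^bsub>M\<^esub> x s) \<in> F i"
      if "finite T" for T
      using that
    proof induction
      case empty
      then show ?case by (simp add: a_minus_def)
    next
      case (insert t T)
      let ?a = "\<Oplus>\<^bsub>M\<^esub>s\<in>T. s \<odot>\<^bsub>M\<^esub> z s k" and ?b = "\<Oplus>\<^bsub>M\<^esub>s\<in>T. s \<odot>\<^bsub>M\<^esub> x s"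
      have t: "t \<in> carrier R" "t \<in> S" using insert S by auto
      have TS: "\<And>s. s \<in> T \<Longrightarrow> s \<in> S \<and> s \<in> carrier R" using insert S by auto
      have ab: "?a \<in> carrier M" "?b \<in> carrier M"
        using TS z xc by (auto intro!: M.finsum_closed)
      have "t \<odot>\<^bsub>M\<^esub> (z t k \<ominus>\<^bsub>M\<^esub> x t) \<oplus>\<^bsub>M\<^esub> (?a \<ominus>\<^bsub>M\<^esub> ?b) \<in> F i"
        using elim t insert by (intro Fi.a_closed submodule.smult_closed[OF sub]) auto
      also have "t \<odot>\<^bsub>M\<^esub> (z t k \<ominus>\<^bsub>M\<^esub> x t) \<oplus>\<^bsub>M\<^esub> (?a \<ominus>\<^bsub>M\<^esub> ?b) =
          (t \<odot>\<^bsub>M\<^esub> z t k \<oplus>\<^bsub>M\<^esub> ?a) \<ominus>\<^bsub>M\<^esub> (t \<odot>\<^bsub>M\<^esub> x t \<oplus>\<^bsub>M\<^esub> ?b)"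
        using ab t z[OF t(2)] xc[OF t(2)]
        by (simp add: a_minus_def smult_r_distr smult_r_minus M.minus_add M.a_ac)
      also have "\<dots> = (\<Oplus>\<^bsub>M\<^esub>s\<in>insert t T. s \<odot>\<^bsub>M\<^esub> z s k) \<ominus>\<^bsub>M\<^esub> (\<Oplus>\<^bsub>M\<^esub>s\<in>insert t T. s \<odot>\<^bsub>M\<^esub> x s)"
        using insert t TS z xc by (simp add: Pi_iff)
      finally show ?case .
    qed
    from this[OF S(1)] show ?case by simp
  qed
qed

section \<open>Adic Cauchy sequences and their limits for the given filtration\<close>

text \<open>Telescoping: by antitonicity, every increment from \<open>m\<close> on lies in the
  \<open>m\<close>-th adic submodule.\<close>

lemma (in module) adic_cauchy_diff:
  assumes a: "ideal \<aa> R" and z: "\<And>k. z k \<in> carrier M"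
    and diff: "\<And>k. z (Suc k) \<ominus>\<^bsub>M\<^esub> z k \<in> adic_filtration R M \<aa> k" and "m \<le> n"
  shows "z n \<ominus>\<^bsub>M\<^esub> z m \<in> adic_filtration R M \<aa> m"
  using \<open>m \<le> n\<close>
proof (induction rule: dec_induct)
  case base
  interpret N: abelian_subgroup "adic_filtration R M \<aa> m" M
    using adic_filtration_submodule[OF a] by (rule submodule_abelian_subgroup)
  show ?case using z by (simp add: M.r_neg a_minus_def)
next
  case (step n)
  then have "z (Suc n) \<ominus>\<^bsub>M\<^esub> z n \<in> adic_filtration R M \<aa> m"
    using diff adic_filtration_antimono[OF a] by blast
  then show ?case using step z by (blast intro: submodule_diff_trans[OF adic_filtration_submodule[OF a]])
qed

text \<open>Since \<open>F i\<close> contains some adic submodule, the sequence is eventually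
  constant modulo \<open>F i\<close>. The eventual cosets form a point of the completion, and a
  preimage of that point is a limit.\<close>

lemma (in module) adic_cauchy_filtration_limit:
  assumes a: "ideal \<aa> R" and F: "filtration R M I leq F"
    and complete: "filtration_complete R M I leq F" and weaker: "weaker_than_adic R M \<aa> I F"
    and z: "\<And>k. z k \<in> carrier M"
    and diff: "\<And>k. z (Suc k) \<ominus>\<^bsub>M\<^esub> z k \<in> adic_filtration R M \<aa> k"
  obtains x where "filtration_limit M I F z x"
proof -
  have sub: "submodule (F i) R M" if "i \<in> I" for i
    using F that by (auto simp: filtration_def)
  have Fc: "F i \<subseteq> carrier M" if "i \<in> I" for i
    using sub[OF that] by (simp add: submodule_def subgroup_def)
  obtain j where j: "\<And>i. i \<in> I \<Longrightarrow> adic_filtration R M \<aa> (j i) \<subseteq> F i"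
    using weaker unfolding weaker_than_adic_def by metis
  have tail: "z k \<ominus>\<^bsub>M\<^esub> z (j i) \<in> F i" if "i \<in> I" "j i \<le> k" for i k
    using adic_cauchy_diff[OF a z diff that(2)] j[OF that(1)] by blast
  \<comment> \<open>By \<open>tail\<close>, this is the eventual coset of the sequence modulo each
    \<open>F i\<close>.\<close>
  define X where "X = (\<lambda>i\<in>I. F i +>\<^bsub>M\<^esub> z (j i))"
  have "quotient_proj M (F i) (X i') = X i" if i: "i \<in> I" "i' \<in> I" "leq i i'" for i i'
  proof -
    \<comment> \<open>The choice function \<open>j\<close> need not be monotone, so the two cosets
      are compared at an index past both thresholds.\<close>
    let ?k = "max (j i) (j i')"
    have sub': "F i' \<subseteq> F i" using F i by (auto simp: filtration_def)
    then have "z ?k \<ominus>\<^bsub>M\<^esub> z (j i) \<in> F i" "z ?k \<ominus>\<^bsub>M\<^esub> z (j i') \<in> F i"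
      using tail i by (auto simp del: max_def)
    then have "F i +>\<^bsub>M\<^esub> z (j i') = F i +>\<^bsub>M\<^esub> z (j i)"
      using sub[OF i(1)] z by (simp flip: submodule_rcos_eq_iff)
    then show ?thesis using i sub sub' z by (simp add: X_def quotient_proj_rcos)
  qed
  then have "X \<in> carrier (completion M I leq F)"
    using M.a_rcosetsI[OF Fc z]
    by (auto simp: X_def completion_def inverse_limit_def quotient_module_def)
  then obtain x where x: "x \<in> carrier M" "completion_map M I F x = X"
    using complete unfolding filtration_complete_iff[OF F] by blast
  have "z k \<ominus>\<^bsub>M\<^esub> x \<in> F i" if i: "i \<in> I" "j i \<le> k" for i k
  proof -
    have "F i +>\<^bsub>M\<^esub> z (j i) = F i +>\<^bsub>M\<^esub> x"
      using fun_cong[OF x(2), of i] i by (simp add: X_def completion_map_def)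
    then have "z (j i) \<ominus>\<^bsub>M\<^esub> x \<in> F i" using sub[OF i(1)] z x by (simp add: submodule_rcos_eq_iff)
    then show ?thesis using tail[OF i] submodule_diff_trans[OF sub[OF i(1)]] z x by blast
  qed
  then have "filtration_limit M I F z x"
    using x unfolding filtration_limit_def eventually_sequentially by blast
  then show ?thesis by (rule that)
qed

section \<open>Limits stay in the adic submodules\<close>

text \<open>The \<open>z k\<close> are partial sums of a series with initial term
  \<open>z 0\<close>. The offset \<open>k + n\<close> makes the hypotheses reproduce themselves:
  removing one factor \<aa> from each term lowers \<open>n\<close> by one and leaves
  \<open>k\<close> alone.\<close>

lemma (in module) filtration_limit_in_adic_filtration:
  assumes fg: "finitely_generated_ideal R \<aa>" and F: "filtration R M I leq F"
    and complete: "filtration_complete R M I leq F" and weaker: "weaker_than_adic R M \<aa> I F"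
    and "z 0 \<in> adic_filtration R M \<aa> n"
    and "\<And>k. z (Suc k) \<ominus>\<^bsub>M\<^esub> z k \<in> adic_filtration R M \<aa> (k + n)"
    and "\<And>k. z k \<in> carrier M" and "filtration_limit M I F z x"
  shows "x \<in> adic_filtration R M \<aa> n"
  using assms(5-)
proof (induction n arbitrary: z x)
  case 0
  then show ?case by (simp add: adic_filtration_0 filtration_limit_def)
next
  case (Suc n)
  have a: "ideal \<aa> R" using fg by (simp add: finitely_generated_ideal_def)
  obtain S where S: "S \<subseteq> carrier R" "finite S" and aS: "\<aa> = Idl S"
    using fg by (auto simp: finitely_generated_ideal_def)
  note sub = adic_filtration_submodule[OF a]
  have adic_carrier: "u \<in> carrier M" if "u \<in> adic_filtration R M \<aa> k" for u k
    using adic_filtration_antimono[OF a, of 0 k] that by (auto simp: adic_filtration_0)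
  have split: "\<exists>y\<in>S \<rightarrow> adic_filtration R M \<aa> k. u = (\<Oplus>\<^bsub>M\<^esub>s\<in>S. s \<odot>\<^bsub>M\<^esub> y s)"
    if "u \<in> adic_filtration R M \<aa> (Suc k)" for u k
    using that ideal_module_prod_genideal_finsum[OF S(2,1) sub[of k], of u]
    by (simp add: adic_filtration_Suc[OF a] flip: aS)
  obtain y0 where y0: "y0 \<in> S \<rightarrow> adic_filtration R M \<aa> n" "z 0 = (\<Oplus>\<^bsub>M\<^esub>s\<in>S. s \<odot>\<^bsub>M\<^esub> y0 s)"
    using split[OF Suc.prems(1)] by blast
  \<comment> \<open>The increment lies in adic step \<open>k + Suc n\<close>, that is
    \<open>Suc (k + n)\<close>; the generators use up one factor.\<close>
  have "\<exists>y\<in>S \<rightarrow> adic_filtration R M \<aa> (k + n). z (Suc k) \<ominus>\<^bsub>M\<^esub> z k = (\<Oplus>\<^bsub>M\<^esub>s\<in>S. s \<odot>\<^bsub>M\<^esub> y s)" for k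
    using split[of _ "k + n"] Suc.prems(2)[of k] by simp
  then obtain y where y: "\<And>k. y k \<in> S \<rightarrow> adic_filtration R M \<aa> (k + n)"
      "\<And>k. z (Suc k) \<ominus>\<^bsub>M\<^esub> z k = (\<Oplus>\<^bsub>M\<^esub>s\<in>S. s \<odot>\<^bsub>M\<^esub> y k s)"
    by metis
  \<comment> \<open>The partial sums of the coefficients at the generator \<open>s\<close>:
    \<open>w s k\<close> is \<open>y0 s\<close> plus all \<open>y l s\<close> with
    \<open>l < k\<close>.\<close>
  define w where "w = (\<lambda>s. rec_nat (y0 s) (\<lambda>k v. y k s \<oplus>\<^bsub>M\<^esub> v))"
  have w0: "w s 0 = y0 s" and wS: "w s (Suc k) = y k s \<oplus>\<^bsub>M\<^esub> w s k" for s k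
    by (auto simp: w_def)
  have yc: "y0 s \<in> carrier M" "y k s \<in> carrier M" if "s \<in> S" for s k
    using that by (auto intro: adic_carrier[OF funcset_mem[OF y0(1)]] adic_carrier[OF funcset_mem[OF y(1)]])
  have wc: "w s k \<in> carrier M" if "s \<in> S" for s k
    using that yc by (induction k) (auto simp: w0 wS)
  have zw: "z k = (\<Oplus>\<^bsub>M\<^esub>s\<in>S. s \<odot>\<^bsub>M\<^esub> w s k)" for k
  proof (induction k)
    case 0
    then show ?case by (simp add: w0 y0(2))
  next
    case (Suc k)
    have "z (Suc k) = (z (Suc k) \<ominus>\<^bsub>M\<^esub> z k) \<oplus>\<^bsub>M\<^esub> z k"
      using Suc.prems \<open>\<And>k. z k \<in> carrier M\<close> by (simp add: a_minus_def M.a_assoc M.l_neg)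
    also have "\<dots> = (\<Oplus>\<^bsub>M\<^esub>s\<in>S. s \<odot>\<^bsub>M\<^esub> y k s) \<oplus>\<^bsub>M\<^esub> (\<Oplus>\<^bsub>M\<^esub>s\<in>S. s \<odot>\<^bsub>M\<^esub> w s k)"
      by (simp only: Suc.IH flip: y(2))
    also have "\<dots> = (\<Oplus>\<^bsub>M\<^esub>s\<in>S. s \<odot>\<^bsub>M\<^esub> y k s \<oplus>\<^bsub>M\<^esub> s \<odot>\<^bsub>M\<^esub> w s k)"
      using S yc wc by (intro M.finsum_addf[symmetric]) auto
    also have "\<dots> = (\<Oplus>\<^bsub>M\<^esub>s\<in>S. s \<odot>\<^bsub>M\<^esub> w s (Suc k))"
      using S yc wc by (intro M.finsum_cong') (auto simp: wS smult_r_distr subset_iff)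
    finally show ?case .
  qed
  have wdiff: "w s (Suc k) \<ominus>\<^bsub>M\<^esub> w s k \<in> adic_filtration R M \<aa> (k + n)" if "s \<in> S" for s k
    using that y(1)[of k] yc wc by (auto simp: wS a_minus_def M.a_assoc M.r_neg)
  have "\<exists>v. filtration_limit M I F (w s) v" if s: "s \<in> S" for s
  proof -
    \<comment> \<open>Existence of a limit only asks for the weaker bound without the offset
      \<open>n\<close>.\<close>
    have "w s (Suc k) \<ominus>\<^bsub>M\<^esub> w s k \<in> adic_filtration R M \<aa> k" for k
      using wdiff[OF s, of k] adic_filtration_antimono[OF a, of k "k + n"] by auto
    then obtain v where "filtration_limit M I F (w s) v"
      using adic_cauchy_filtration_limit[OF a F complete weaker, of "w s"] wc[OF s] by blast
    then show ?thesis ..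
  qed
  then obtain v where v: "\<And>s. s \<in> S \<Longrightarrow> filtration_limit M I F (w s) (v s)"
    by metis
  \<comment> \<open>The induction hypothesis is applied to \<open>w s\<close> and
    \<open>v s\<close>, hence the generalization over \<open>z\<close> and \<open>x\<close>.\<close>
  have vn: "v s \<in> adic_filtration R M \<aa> n" if s: "s \<in> S" for s
    using Suc.IH[OF _ wdiff[OF s] wc[OF s] v[OF s]] y0(1) s by (auto simp: w0)
  have "filtration_limit M I F z (\<Oplus>\<^bsub>M\<^esub>s\<in>S. s \<odot>\<^bsub>M\<^esub> v s)"
    unfolding zw by (rule filtration_limit_finsum_smult[OF F S(2,1) wc v])
  \<comment> \<open>Both sides are limits of \<open>z\<close>; uniqueness expresses the given limit
    through the generators.\<close>
  then have x: "x = (\<Oplus>\<^bsub>M\<^esub>s\<in>S. s \<odot>\<^bsub>M\<^esub> v s)"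
    using Suc.prems filtration_limit_unique[OF F complete] by blast
  interpret N: abelian_subgroup "adic_filtration R M \<aa> (Suc n)" M
    by (rule submodule_abelian_subgroup[OF sub])
  have smult_mem: "s \<odot>\<^bsub>M\<^esub> v s \<in> adic_filtration R M \<aa> (Suc n)" if "s \<in> S" for s
    unfolding adic_filtration_Suc[OF a]
    using that vn R.genideal_self[OF S(1)] by (intro ideal_module_prod.smult) (auto simp: aS)
  have "T \<subseteq> S \<Longrightarrow> (\<Oplus>\<^bsub>M\<^esub>s\<in>T. s \<odot>\<^bsub>M\<^esub> v s) \<in> adic_filtration R M \<aa> (Suc n)" if "finite T" for T
    using that
  proof induction
    case (insert t T)
    then have "\<And>s. s \<in> insert t T \<Longrightarrow> s \<odot>\<^bsub>M\<^esub> v s \<in> adic_filtration R M \<aa> (Suc n)"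
      using smult_mem by blast
    then show ?case using insert by (simp add: Pi_iff)
  qed simp
  then show ?case using S(2) by (simp add: x)
qed

section \<open>Passage from completeness for the given filtration to adic completeness\<close>

theorem theorem0p1:
  fixes A :: "('a, 'b) ring_scheme"
    and \<aa> :: "'a set"
    and M :: "('a, 'm, 'p) module_scheme"
    and I :: "'i set"
    and leq :: "'i \<Rightarrow> 'i \<Rightarrow> bool"
    and F :: "'i \<Rightarrow> 'm set"
  assumes "cring A"
    and "finitely_generated_ideal A \<aa>"
    and "module A M"
    and "directed_set I leq"
    and "filtration A M I leq F"
    and "filtration_complete A M I leq F"
    and "weaker_than_adic A M \<aa> I F"
  shows "adically_complete A M \<aa>"
proof -
  interpret module A M by fact
  note fg = assms(2) and F = assms(5) and complete = assms(6) and weaker = assms(7)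
  have a: "ideal \<aa> A" using fg by (simp add: finitely_generated_ideal_def)
  let ?N = "adic_filtration A M \<aa>"
  have sub: "submodule (?N n) A M" for n by (rule adic_filtration_submodule[OF a])
  \<comment> \<open>Each \<open>F i\<close> contains some \<open>?N n\<close>, so the intersection
    of the adic submodules lies in that of the \<open>F i\<close>, which is zero.\<close>
  have separated: "x = \<zero>\<^bsub>M\<^esub>" if x: "x \<in> carrier M" "\<And>n. x \<in> ?N n" for x
  proof -
    have "x \<in> F i" if "i \<in> I" for i
      using weaker that x(2) unfolding weaker_than_adic_def by blast
    then show ?thesis using complete x(1) by (simp add: filtration_complete_iff[OF F])
  qed
  have surj: "X \<in> completion_map M UNIV ?N ` carrier M"
    if X: "X \<in> carrier (completion M UNIV (\<le>) ?N)" for X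
  proof -
    have "\<exists>x\<in>carrier M. X n = ?N n +>\<^bsub>M\<^esub> x" for n
      using X by (auto simp: completion_def inverse_limit_def quotient_module_def A_RCOSETS_def'
          PiE_iff)
    then obtain z where z: "\<And>n. z n \<in> carrier M" "\<And>n. X n = ?N n +>\<^bsub>M\<^esub> z n" by metis
    \<comment> \<open>Compatibility of the components of \<open>X\<close> makes any choice of
      representatives adically Cauchy.\<close>
    have diff: "z (Suc n) \<ominus>\<^bsub>M\<^esub> z n \<in> ?N n" for n
    proof -
      have "quotient_proj M (?N n) (X (Suc n)) = X n"
        using X by (simp add: completion_def inverse_limit_def)
      then show ?thesis
        using z sub adic_filtration_antimono[OF a, of n "Suc n"]
        by (simp add: quotient_proj_rcos submodule_rcos_eq_iff)
    qed
    obtain x where x: "filtration_limit M I F z x"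
      using adic_cauchy_filtration_limit[OF a F complete weaker z(1) diff] .
    then have xc: "x \<in> carrier M" by (simp add: filtration_limit_def)
    have xz: "x \<ominus>\<^bsub>M\<^esub> z n \<in> ?N n" for n
    proof (rule filtration_limit_in_adic_filtration[OF fg F complete weaker])
      let ?u = "\<lambda>k. z (k + n) \<ominus>\<^bsub>M\<^esub> z n"
      show "?u 0 \<in> ?N n"
        using adic_cauchy_diff[OF a z(1) diff, of n n] by simp
      show "?u (Suc k) \<ominus>\<^bsub>M\<^esub> ?u k \<in> ?N (k + n)" for k
        using diff[of "k + n"] z(1) by (simp add: M.minus_minus_cancel_right)
      show "?u k \<in> carrier M" for k using z(1) by simp
      have "eventually (\<lambda>k. z (k + n) \<ominus>\<^bsub>M\<^esub> x \<in> F i) sequentially" if "i \<in> I" for i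
        using x that eventually_sequentially_seg[of "\<lambda>k. z k \<ominus>\<^bsub>M\<^esub> x \<in> F i" n]
        by (simp add: filtration_limit_def)
      then show "filtration_limit M I F ?u (x \<ominus>\<^bsub>M\<^esub> z n)"
        using xc z(1) by (simp add: filtration_limit_def M.minus_minus_cancel_right)
    qed
    have "X n = ?N n +>\<^bsub>M\<^esub> x" for n
      unfolding z(2) using submodule_rcos_eq_iff[OF sub xc z(1)] xz by metis
    then have "completion_map M UNIV ?N x = X" by (auto simp: completion_map_def)
    then show ?thesis using xc by blast
  qed
  show ?thesis
    unfolding adically_complete_def filtration_complete_iff[OF adic_filtration_filtration[OF a]]
    using separated surj by blast
qed

end
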